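(* There is a data structure in the cell-probe model for $n$-vertex interval graphs given in universal interval representation that answers adjacency queries $\mathrm{adj}(u,v)$ with $O(1)$ cell probes and uses $\log_2(n!)+O(1)$ bits of space.
   Context: An interval graph has an interval $I_v$ of the real line for each vertex $v$, with $u,v$ adjacent iff $I_u\cap I_v\neq\emptyset$. A universal interval representation of an $n$-vertex interval graph is an interval representation in which every $i\in[n]$ is the left endpoint of exactly one interval; vertex $i$ is identified with $I_i=[i,e_i]$ with integer $e_i\in[i,n]$. In the cell-probe model (word size $\Theta(\log n)$), preprocessing and query algorithms have unlimited computational power and the query cost is the number of memory cells read, adaptively. *)

theory Defs
  imports Complex_Main "HOL-Library.FuncSet" "HOL-Library.Landau_Symbols"
begin

text \<open>
  The graph of a family of sets: simple, so no vertex is adjacent to itself.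
\<close>

definition intersection_adj :: "('v \<Rightarrow> real set) \<Rightarrow> 'v \<Rightarrow> 'v \<Rightarrow> bool" where
  "intersection_adj I u v \<longleftrightarrow> u \<noteq> v \<and> I u \<inter> I v \<noteq> {}"

text \<open>
  The vertices are \<open>1, \<dots>, n\<close>; vertex \<open>i\<close> is the one whose interval has left endpoint \<open>i\<close>, so a
  universal representation amounts to the family of its integer right endpoints.
\<close>

definition universal_representations :: "nat \<Rightarrow> (nat \<Rightarrow> nat) set" where
  "universal_representations n = (\<Pi>\<^sub>E i\<in>{1..n}. {i..n})"

definition vertex_interval :: "(nat \<Rightarrow> nat) \<Rightarrow> nat \<Rightarrow> real set" where
  "vertex_interval e i = {real i..real (e i)}"

text \<open>
  Memory is a bit string divided into consecutive cells of \<open>w\<close> bits. So that space can be counted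
  in bits, its length need not be a multiple of \<open>w\<close>; the last cell may then be shorter.
\<close>

definition cell :: "nat \<Rightarrow> bool list \<Rightarrow> nat \<Rightarrow> bool list" where
  "cell w M j = take w (drop (j * w) M)"

text \<open>
  A query algorithm is a decision tree: the next address, or the answer, is an arbitrary function
  of the cell contents read so far, and only probes are charged.
\<close>

datatype 'r probe_algorithm =
  Return 'r
| Probe nat "bool list \<Rightarrow> 'r probe_algorithm"

primrec result :: "nat \<Rightarrow> bool list \<Rightarrow> 'r probe_algorithm \<Rightarrow> 'r" where
  "result w M (Return r) = r"
| "result w M (Probe j k) = result w M (k (cell w M j))"

primrec probes :: "nat \<Rightarrow> bool list \<Rightarrow> 'r probe_algorithm \<Rightarrow> nat" where
  "probes w M (Return r) = 0"
| "probes w M (Probe j k) = Suc (probes w M (k (cell w M j)))"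

text \<open>
  Word size \<open>w\<close>, space exactly \<open>s\<close> bits, at most \<open>t\<close> probes per query. The space is the same for all
  inputs in \<open>X\<close>, so the length of the memory carries no information.
\<close>

definition cell_probe_structure ::
  "nat \<Rightarrow> nat \<Rightarrow> nat \<Rightarrow> 'x set \<Rightarrow> 'q set \<Rightarrow> ('x \<Rightarrow> 'q \<Rightarrow> 'r) \<Rightarrow>
   ('x \<Rightarrow> bool list) \<Rightarrow> ('q \<Rightarrow> 'r probe_algorithm) \<Rightarrow> bool" where
  "cell_probe_structure w s t X Q f preprocess query \<longleftrightarrow>
     (\<forall>x\<in>X. length (preprocess x) = s \<and>
       (\<forall>q\<in>Q. result w (preprocess x) (query q) = f x q \<and>
              probes w (preprocess x) (query q) \<le> t))"

end

theory Submission imports Defs "HOL-Library.Log_Nat" "HOL-Library.Countable_Set"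
begin

text \<open>
  Adjacency of \<open>u < v\<close> means \<open>v \<le> e u\<close>, so it suffices to store the right endpoints, an array whose
  alphabets have sizes \<open>1, \<dots>, n\<close> and hence product \<open>n!\<close>, so that each entry can be read locally
  (the spillover technique of Dodis, Patrascu and Thorup). Group the endpoints in blocks of four;
  block \<open>k\<close>, counted from the small alphabets, takes one of \<open>X k \<ge> (k + 1)^4\<close> values \<open>x k\<close>.
  Split \<open>x k\<close> into \<open>x k mod Y k\<close> and the spill \<open>x k div Y k\<close>. Memory word \<open>k\<close> combines the
  former with the spill of block \<open>k - 1\<close>, and \<open>Y k\<close> is the largest number for which this pair
  fits into the word, so \<open>x k\<close> is determined by words \<open>k\<close> and \<open>k + 1\<close>. The word length is
  chosen such that \<open>Y k\<close> is about \<open>(k + 1)^2\<close>; then both roundings waste a factor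
  \<open>1 + O(1 / (k + 1)^2)\<close>, and the product of these factors over all blocks is bounded.
\<close>

section \<open>Reading a segment of the memory\<close>

primrec read_cells :: "nat list \<Rightarrow> (bool list \<Rightarrow> 'r probe_algorithm) \<Rightarrow> 'r probe_algorithm" where
  "read_cells [] k = k []"
| "read_cells (j # js) k = Probe j (\<lambda>c. read_cells js (\<lambda>bs. k (c @ bs)))"

lemma result_read_cells:
  "result w M (read_cells js k) = result w M (k (concat (map (cell w M) js)))"
  by (induction js arbitrary: k) auto

lemma probes_read_cells:
  "probes w M (read_cells js k) = length js + probes w M (k (concat (map (cell w M) js)))"
  by (induction js arbitrary: k) auto

lemma concat_cells: "concat (map (cell w M) [j..<j + c]) = take (c * w) (drop (j * w) M)"
proof (induction c)
  case (Suc c)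
  have "take (Suc c * w) (drop (j * w) M) = take (c * w + w) (drop (j * w) M)"
    by (simp add: add.commute)
  also have "\<dots> = take (c * w) (drop (j * w) M) @ take w (drop (c * w + j * w) M)"
    by (simp add: take_add)
  finally show ?case using Suc by (simp add: cell_def algebra_simps)
qed simp

text \<open>Neither end of the segment need be aligned: both \<open>a mod w\<close> and
  \<open>l mod w\<close> are below \<open>w\<close>, so together they add at most two cells to the
  \<open>l div w\<close> full ones.\<close>

definition read_segment :: "nat \<Rightarrow> nat \<Rightarrow> nat \<Rightarrow> (bool list \<Rightarrow> 'r) \<Rightarrow> 'r probe_algorithm" where
  "read_segment w a l f =
     read_cells [a div w..<a div w + (l div w + 2)] (\<lambda>bs. Return (f (take l (drop (a mod w) bs))))"

lemma result_read_segment: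
  assumes "w > 0"
  shows "result w M (read_segment w a l f) = f (take l (drop a M))"
proof -
  have "l + a mod w \<le> (l div w + 2) * w"
  proof -
    have "l = l div w * w + l mod w" "l mod w < w" "a mod w < w" using assms by simp_all
    then show ?thesis unfolding distrib_right by linarith
  qed
  moreover have "a mod w + a div w * w = a" by simp
  ultimately have "take l (drop (a mod w) (take ((l div w + 2) * w) (drop (a div w * w) M)))
      = take l (drop a M)"
    by (simp add: drop_take min_absorb1)
  then show ?thesis unfolding read_segment_def result_read_cells concat_cells result.simps by simp
qed

lemma probes_read_segment: "probes w M (read_segment w a l f) = l div w + 2"
  by (simp add: read_segment_def probes_read_cells del: upt_Suc)

section \<open>Arrays over varying alphabets\<close>

definition bits :: "nat \<Rightarrow> nat \<Rightarrow> bool list" where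
  "bits l v = map (bit v) [0..<l]"

lemma length_bits [simp]: "length (bits l v) = l"
  by (simp add: bits_def)

definition value_of_bits :: "bool list \<Rightarrow> nat" where
  "value_of_bits bs = horner_sum of_bool 2 bs"

lemma value_of_bits_bits: "v < 2 ^ l \<Longrightarrow> value_of_bits (bits l v) = v"
  by (simp add: bits_def value_of_bits_def horner_sum_bit_eq_take_bit take_bit_nat_eq_self)

text \<open>\<open>X\<close> gives the alphabet sizes, \<open>T\<close> lower bounds for the moduli \<open>low\<close>.\<close>

locale spillover =
  fixes X T :: "nat \<Rightarrow> nat"
  assumes X_pos: "X k > 0" and T_pos: "T k > 0"
begin

text \<open>The number of possible spills entering word \<open>k\<close>; the divisor is \<open>low k\<close>.\<close>

primrec spill :: "nat \<Rightarrow> nat" where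
  "spill 0 = 1"
| "spill (Suc k) = X k div (2 ^ ceillog2 (spill k * T k) div spill k) + 1"

definition width :: "nat \<Rightarrow> nat" where
  "width k = ceillog2 (spill k * T k)"

definition low :: "nat \<Rightarrow> nat" where
  "low k = 2 ^ width k div spill k"

definition offset :: "nat \<Rightarrow> nat" where
  "offset k = (\<Sum>j<k. width j)"

primrec state :: "(nat \<Rightarrow> nat) \<Rightarrow> nat \<Rightarrow> nat" where
  "state x 0 = 0"
| "state x (Suc k) = x k div low k"

definition encode_word :: "(nat \<Rightarrow> nat) \<Rightarrow> nat \<Rightarrow> nat" where
  "encode_word x k = state x k * low k + x k mod low k"

definition memory :: "nat \<Rightarrow> (nat \<Rightarrow> nat) \<Rightarrow> bool list" where
  "memory m x = concat (map (\<lambda>k. bits (width k) (encode_word x k)) [0..<m])"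

text \<open>The argument is word \<open>k\<close> followed by word \<open>k + 1\<close>: the leading
  digit of the latter is the quotient of \<open>x k\<close> by \<open>low k\<close>, the last digit
  of the former the remainder.\<close>

definition decode :: "nat \<Rightarrow> bool list \<Rightarrow> nat" where
  "decode k bs = value_of_bits (drop (width k) bs) div low (Suc k) * low k
     + value_of_bits (take (width k) bs) mod low k"

lemma spill_Suc: "spill (Suc k) = X k div low k + 1"
  by (simp add: low_def width_def)

lemma spill_pos: "spill k > 0"
  by (cases k) auto

lemma width_lower: "spill k * T k \<le> 2 ^ width k"
  unfolding width_def by (rule le_two_power_ceillog2)

lemma width_upper: "2 ^ width k \<le> 2 * (spill k * T k)"
  unfolding width_def using two_power_ceillog2_gt spill_pos T_pos by (simp add: less_imp_le)

lemma low_lower: "T k \<le> low k"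
  unfolding low_def using width_lower[of k] spill_pos[of k]
  by (simp add: less_eq_div_iff_mult_less_eq mult.commute)

lemma low_pos: "low k > 0"
  using low_lower[of k] T_pos[of k] by linarith

text \<open>Rounding up to a power of two costs at most a factor 2. This keeps \<open>low k\<close>
  small against \<open>X k\<close>, so that the \<open>+ 1\<close> in the next spill is a small
  relative error.\<close>

lemma low_upper: "low k \<le> 2 * T k"
proof -
  have "low k \<le> (2 * T k * spill k) div spill k"
    unfolding low_def using width_upper[of k] by (intro div_le_mono) (simp add: mult_ac)
  then show ?thesis using spill_pos[of k] by simp
qed

lemma state_less_spill:
  assumes "\<And>k. x k < X k"
  shows "state x k < spill k"
proof (cases k)
  case (Suc l)
  have "x l div low l \<le> X l div low l" using assms[of l] by (intro div_le_mono) simp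
  then show ?thesis using Suc by (simp add: spill_Suc del: spill.simps(2))
qed simp

lemma encode_word_less:
  assumes "\<And>k. x k < X k"
  shows "encode_word x k < 2 ^ width k"
proof -
  have "encode_word x k < (state x k + 1) * low k"
    using low_pos[of k] by (simp add: encode_word_def)
  also have "\<dots> \<le> spill k * low k"
    using state_less_spill[OF assms, of k] by (intro mult_right_mono) simp_all
  also have "\<dots> \<le> 2 ^ width k" by (simp add: low_def)
  finally show ?thesis .
qed

lemma length_memory: "length (memory m x) = offset m"
  by (induction m) (simp_all add: memory_def offset_def)

lemma segment_memory:
  assumes "Suc k < m"
  shows "take (width k + width (Suc k)) (drop (offset k) (memory m x))
    = bits (width k) (encode_word x k) @ bits (width (Suc k)) (encode_word x (Suc k))"
proof -
  have "[0..<m] = [0..<k] @ k # Suc k # [Suc (Suc k)..<m]"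
    using assms upt_add_eq_append[of 0 k "m - k"] by (simp add: upt_conv_Cons)
  then have "memory m x = memory k x @ bits (width k) (encode_word x k)
      @ bits (width (Suc k)) (encode_word x (Suc k))
      @ concat (map (\<lambda>k. bits (width k) (encode_word x k)) [Suc (Suc k)..<m])"
    by (simp add: memory_def)
  then show ?thesis by (simp add: length_memory)
qed

lemma decode_segment:
  assumes "\<And>k. x k < X k" "Suc k < m"
  shows "decode k (take (width k + width (Suc k)) (drop (offset k) (memory m x))) = x k"
proof -
  have "encode_word x (Suc k) div low (Suc k) = x k div low k"
    using low_pos[of "Suc k"] by (simp add: encode_word_def)
  moreover have "encode_word x k mod low k = x k mod low k"
    by (simp add: encode_word_def)
  ultimately show ?thesis
    by (simp add: decode_def segment_memory[OF assms(2)] value_of_bits_bits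
        encode_word_less[OF assms(1)])
qed

section \<open>Sizes of single words and of the whole memory\<close>

lemma spill_le:
  assumes "\<And>k. X k \<le> b"
  shows "spill k \<le> 2 * b"
proof -
  have "b \<ge> 1" using X_pos[of 0] assms[of 0] by linarith
  moreover have "X l div low l \<le> b" for l
    using div_le_dividend[of "X l" "low l"] assms[of l] by linarith
  ultimately have "X l div low l + 1 \<le> 2 * b" for l
    by (metis add_mono mult_2)
  then show ?thesis using \<open>b \<ge> 1\<close> by (cases k) (simp_all add: spill_Suc del: spill.simps(2))
qed

text \<open>Bounds the bits that one lookup reads: with \<open>b\<close> and \<open>c\<close>
  polynomial in \<open>n\<close>, two consecutive words have O(log n) bits.\<close>

lemma width_le:
  assumes "\<And>k. X k \<le> b" "\<And>k. T k \<le> c"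
  shows "2 ^ (width k + width (Suc k)) \<le> (4 * b * c) ^ 2"
proof -
  have "2 ^ width l \<le> 4 * b * c" for l
  proof -
    have "2 ^ width l \<le> 2 * (spill l * T l)" by (rule width_upper)
    also have "\<dots> \<le> 2 * (2 * b * c)"
      using spill_le[OF assms(1)] assms(2) by (intro mult_left_mono mult_mono) auto
    finally show ?thesis by simp
  qed
  then show ?thesis unfolding power_add power2_eq_square by (intro mult_mono) auto
qed

text \<open>Counting the pending spill on the left makes the induction multiplicative: with Y =
  \<open>low m\<close> and X = \<open>X m\<close>, word \<open>m\<close> contributes at most (Y + 1)
  (X / Y + 1) = X (1 + 1 / Y) (1 + Y / X). The last two factors are the losses from rounding
  \<open>low m\<close> and the next spill.\<close>

lemma offset_bound:
  "2 ^ offset m * real (spill m)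
     \<le> (\<Prod>k<m. real (X k)) * exp (\<Sum>k<m. 1 / real (T k) + 2 * real (T k) / real (X k))"
proof (induction m)
  case 0
  then show ?case by (simp add: offset_def)
next
  case (Suc m)
  let ?Y = "real (low m)" and ?X = "real (X m)" and ?T = "real (T m)"
  let ?P = "\<Prod>k<m. real (X k)"
  let ?E = "exp (\<Sum>k<m. 1 / real (T k) + 2 * real (T k) / real (X k))"
  have pos: "?Y > 0" "?X > 0" "?T > 0" using low_pos X_pos T_pos by simp_all
  have "2 ^ width m \<le> spill m * (low m + 1)"
    using dividend_less_times_div[OF spill_pos[of m], of "2 ^ width m"] by (simp add: low_def)
  then have width: "2 ^ width m \<le> real (spill m) * (?Y + 1)"
    by (simp add: algebra_simps flip: of_nat_le_iff[where 'a = real])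
  have spill: "real (spill (Suc m)) \<le> ?X / ?Y + 1"
    using of_nat_div_le_of_nat[of "X m" "low m"] by (simp add: spill_Suc del: spill.simps(2))
  have "(?Y + 1) * (?X / ?Y + 1) = ?X * ((1 + 1 / ?Y) * (1 + ?Y / ?X))"
    using pos by (simp add: field_simps)
  \<comment> \<open>The first loss needs Y at least T, the second Y at most 2 T.\<close>
  also have "\<dots> \<le> ?X * ((1 + 1 / ?T) * (1 + 2 * ?T / ?X))"
    using pos low_lower[of m] low_upper[of m]
    by (intro mult_left_mono mult_mono add_left_mono divide_left_mono divide_right_mono) auto
  also have "\<dots> \<le> ?X * (exp (1 / ?T) * exp (2 * ?T / ?X))"
    using pos by (intro mult_left_mono mult_mono exp_ge_add_one_self) auto
  finally have step: "(?Y + 1) * (?X / ?Y + 1) \<le> ?X * exp (1 / ?T + 2 * ?T / ?X)"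
    by (simp add: exp_add)
  have "2 ^ offset (Suc m) * real (spill (Suc m))
      = 2 ^ offset m * (2 ^ width m * real (spill (Suc m)))"
    by (simp add: offset_def power_add del: spill.simps(2))
  also have "\<dots> \<le> 2 ^ offset m * ((real (spill m) * (?Y + 1)) * (?X / ?Y + 1))"
    using width spill by (intro mult_left_mono mult_mono) auto
  also have "\<dots> = (2 ^ offset m * real (spill m)) * ((?Y + 1) * (?X / ?Y + 1))"
    by (simp only: mult_ac)
  also have "\<dots> \<le> (?P * ?E) * (?X * exp (1 / ?T + 2 * ?T / ?X))"
    by (rule mult_mono[OF Suc step]) (auto intro!: mult_nonneg_nonneg prod_nonneg)
  also have "\<dots> = (?P * ?X) * (?E * exp (1 / ?T + 2 * ?T / ?X))" by (simp only: mult_ac)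
  finally show ?case by (simp add: exp_add)
qed

end

section \<open>Blocks of right endpoints\<close>

text \<open>
  Vertices are counted from the right and aligned such that only block \<open>0\<close>, which contains the
  smallest alphabets, may have fewer than four elements. Blocks from \<open>block_count n\<close> on are empty;
  the first of them makes room for the last spill, at constant cost since its target is \<open>1\<close>.
\<close>

definition block_count :: "nat \<Rightarrow> nat" where
  "block_count n = (n + 3) div 4"

definition block :: "nat \<Rightarrow> nat \<Rightarrow> nat set" where
  "block n k = {i \<in> {1..n}. (4 * block_count n - i) div 4 = k}"

definition block_values :: "nat \<Rightarrow> nat \<Rightarrow> (nat \<Rightarrow> nat) set" where
  "block_values n k = (\<Pi>\<^sub>E i\<in>block n k. {i..n})"

definition block_target :: "nat \<Rightarrow> nat \<Rightarrow> nat" where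
  "block_target n k = (if k < block_count n then (k + 1) ^ 2 else 1)"

lemma block_count_bounds: "n \<le> 4 * block_count n" "4 * block_count n \<le> n + 3"
  unfolding block_count_def by linarith+

lemma finite_block [simp]: "finite (block n k)"
  by (simp add: block_def)

lemma block_empty: "k \<ge> block_count n \<Longrightarrow> block n k = {}"
  using block_count_bounds(1)[of n] by (auto simp: block_def)

lemma block_interval:
  "block n k \<subseteq> {4 * block_count n - 4 * k - 3..4 * block_count n - 4 * k}"
proof
  fix i assume "i \<in> block n k"
  then have "i \<le> n" "(4 * block_count n - i) div 4 = k" by (auto simp: block_def)
  then show "i \<in> {4 * block_count n - 4 * k - 3..4 * block_count n - 4 * k}"
    using block_count_bounds(1)[of n] unfolding atLeastAtMost_iff by linarith
qed

lemma card_block_le: "card (block n k) \<le> 4"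
  using card_mono[OF _ block_interval[of n k]] by simp

lemma card_block:
  assumes "0 < k" "k < block_count n"
  shows "card (block n k) = 4"
proof -
  have "{4 * block_count n - 4 * k - 3..4 * block_count n - 4 * k} \<subseteq> block n k"
  proof
    fix i assume "i \<in> {4 * block_count n - 4 * k - 3..4 * block_count n - 4 * k}"
    then have *: "4 * block_count n - 4 * k - 3 \<le> i" "i \<le> 4 * block_count n - 4 * k" by auto
    then have "4 * k \<le> 4 * block_count n - i" "4 * block_count n - i < 4 * k + 4"
      using assms(2) by linarith+
    then have "(4 * block_count n - i) div 4 = k" by linarith
    moreover have "1 \<le> i" "i \<le> n"
      using * assms block_count_bounds(2)[of n] by linarith+
    ultimately show "i \<in> block n k" by (simp add: block_def)
  qed
  with block_interval[of n k]
  have "block n k = {4 * block_count n - 4 * k - 3..4 * block_count n - 4 * k}" by blast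
  then show ?thesis using assms(2) by simp
qed

lemma finite_block_values [simp]: "finite (block_values n k)"
  by (simp add: block_values_def finite_PiE)

lemma card_block_values: "card (block_values n k) = (\<Prod>i\<in>block n k. n + 1 - i)"
  by (simp add: block_values_def card_PiE)

lemma card_block_values_pos: "card (block_values n k) > 0"
  by (auto simp: card_block_values block_def intro!: prod_pos)

lemma card_block_values_le:
  assumes "n > 0"
  shows "card (block_values n k) \<le> n ^ 4"
proof -
  have "card (block_values n k) \<le> (\<Prod>i\<in>block n k. n)"
    unfolding card_block_values by (intro prod_mono) (auto simp: block_def)
  also have "\<dots> \<le> n ^ 4"
    using assms card_block_le[of n k] by (simp add: power_increasing)
  finally show ?thesis .
qed

text \<open>For \<open>k > 0\<close> the block has four vertices, each with at least 4 k - 2 >= k +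
  1 possible endpoints, as the alignment shifts by at most 3. The possibly incomplete block 0 only
  has to have some value.\<close>

lemma card_block_values_ge:
  assumes "k < block_count n"
  shows "(k + 1) ^ 4 \<le> card (block_values n k)"
proof (cases "k = 0")
  case True
  then show ?thesis using card_block_values_pos[of n k] by simp
next
  case False
  have "(k + 1) ^ 4 = (\<Prod>i\<in>block n k. k + 1)"
    using False assms by (simp add: card_block)
  also have "\<dots> \<le> (\<Prod>i\<in>block n k. n + 1 - i)"
  proof (intro prod_mono conjI)
    fix i assume "i \<in> block n k"
    then have "i \<le> 4 * block_count n - 4 * k" using block_interval[of n k] by auto
    then show "k + 1 \<le> n + 1 - i"
      using False assms block_count_bounds(2)[of n] by linarith
  qed simp
  finally show ?thesis by (simp add: card_block_values)
qed

text \<open>The blocks partition the vertices, and vertex \<open>i\<close> has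
  \<open>n + 1 - i\<close> possible endpoints, so grouping by itself wastes nothing.\<close>

lemma prod_card_block_values: "(\<Prod>k<block_count n. card (block_values n k)) = fact n"
proof -
  have "(\<Prod>k<block_count n. card (block_values n k)) = (\<Prod>i\<in>{1..n}. n + 1 - i)"
    unfolding card_block_values block_def
    using block_count_bounds(1)[of n] by (intro prod.group) auto
  also have "\<dots> = \<Prod>{1..n}"
    by (rule prod.reindex_bij_witness[of _ "\<lambda>i. n + 1 - i" "\<lambda>i. n + 1 - i"]) auto
  finally show ?thesis by (simp add: fact_prod)
qed

lemma block_target_le:
  assumes "n > 0"
  shows "block_target n k \<le> n ^ 2"
proof (cases "k < block_count n")
  case True
  then have "k + 1 \<le> n" using block_count_bounds(2)[of n] by linarith
  then show ?thesis using True by (simp add: block_target_def power_mono del: One_nat_def)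
qed (use assms in \<open>simp add: block_target_def Suc_le_eq\<close>)

section \<open>Boundedness of the total rounding loss\<close>

text \<open>The subtracted term lets the induction telescope, by 1 / (m + 1)^2 <= 1 / m - 1 / (m +
  1).\<close>

lemma sum_inverse_squares: "(\<Sum>k<m. 1 / real ((k + 1) ^ 2)) \<le> 2 - (if m = 0 then 0 else 1 / real m)"
proof (induction m)
  case (Suc m)
  have "1 / real ((m + 1) ^ 2) \<le> 1 / real m - 1 / real (m + 1)" if "m > 0"
    using that by (simp add: divide_simps power2_eq_square) (auto simp: algebra_simps not_less)
  then show ?case using Suc by (cases "m = 0") auto
qed simp

text \<open>Block \<open>k\<close> loses at most 3 / (k + 1)^2, in total at most 6. The final empty
  block has target 1 and one value, the empty function, and adds 1 + 2 = 3.\<close>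

lemma sum_loss:
  "(\<Sum>k<Suc (block_count n). 1 / real (block_target n k)
      + 2 * real (block_target n k) / real (card (block_values n k))) \<le> 9"
proof -
  have "1 / real (block_target n k) + 2 * real (block_target n k) / real (card (block_values n k))
      \<le> 3 * (1 / real ((k + 1) ^ 2))" if "k < block_count n" for k
  proof -
    have "real ((k + 1) ^ 2) * real ((k + 1) ^ 2) \<le> real (card (block_values n k))"
      using card_block_values_ge[OF that]
      by (simp flip: of_nat_mult power_add del: of_nat_power of_nat_add of_nat_Suc)
    then have "real ((k + 1) ^ 2) / real (card (block_values n k)) \<le> 1 / real ((k + 1) ^ 2)"
      using card_block_values_pos[of n k]
      by (simp add: divide_simps del: of_nat_power of_nat_add)
    then show ?thesis using that by (simp add: block_target_def)
  qed
  then have "(\<Sum>k<block_count n. 1 / real (block_target n k)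
      + 2 * real (block_target n k) / real (card (block_values n k)))
      \<le> (\<Sum>k<block_count n. 3 * (1 / real ((k + 1) ^ 2)))"
    by (intro sum_mono) auto
  also have "\<dots> = 3 * (\<Sum>k<block_count n. 1 / real ((k + 1) ^ 2))"
    by (simp only: sum_distrib_left)
  also have "\<dots> \<le> 3 * 2"
    using sum_inverse_squares[of "block_count n"]
    by (intro mult_left_mono) (auto intro: order_trans)
  finally show ?thesis
    by (simp add: block_target_def card_block_values block_empty)
qed

section \<open>Adjacency queries on the encoded endpoints\<close>

text \<open>The interval that starts later is nonempty, so the two meet exactly if its left endpoint
  lies in the other one. Hence a query decodes a single endpoint.\<close>

lemma adjacency_iff:
  assumes "e \<in> universal_representations n" "u \<in> {1..n}" "v \<in> {1..n}"
  shows "intersection_adj (vertex_interval e) u v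
    \<longleftrightarrow> u \<noteq> v \<and> max u v \<le> e (min u v)"
proof -
  have *: "w \<le> e w" if "w \<in> {1..n}" for w
    using assms(1) that by (auto simp: universal_representations_def dest: PiE_mem)
  have "{real u..real (e u)} \<inter> {real v..real (e v)} \<noteq> {} \<longleftrightarrow> max u v \<le> e (min u v)"
    using *[OF assms(2)] *[OF assms(3)] by (auto simp: Int_atLeastAtMost max_def min_def)
  then show ?thesis by (simp add: intersection_adj_def vertex_interval_def)
qed

text \<open>The hypothesis on \<open>K\<close> says that two consecutive words fit into
  \<open>K\<close> cells, since their length is at most the logarithm of (4 n^4 n^2)^2. The constant
  \<open>9 / ln 2\<close> is the binary logarithm of \<open>exp 9\<close>.\<close>

lemma adjacency_structure:
  assumes "n > 0" "w > 0" and w: "12 * log 2 (real n) + 4 \<le> real (K * w)"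
  shows "\<exists>preprocess query s.
    cell_probe_structure w s (K + 2) (universal_representations n) ({1..n} \<times> {1..n})
      (\<lambda>e (u, v). intersection_adj (vertex_interval e) u v) preprocess query \<and>
    real s \<le> log 2 (fact n) + 9 / ln 2"
proof -
  define X where "X k = card (block_values n k)" for k
  interpret spillover X "block_target n"
    by standard (auto simp: X_def card_block_values_pos block_target_def)
  define m where "m = Suc (block_count n)"
  \<comment> \<open>Any numbering of the finite set of block values will do, as computation is free;
    restricting \<open>e\<close> makes it an element of that set.\<close>
  define x where "x e k = to_nat_on (block_values n k) (restrict e (block n k))" for e k
  define k where "k i = (4 * block_count n - i) div 4" for i
  define answer where
    "answer u v bs = (u \<noteq> v \<and> max u v \<le>
        from_nat_into (block_values n (k (min u v))) (decode (k (min u v)) bs) (min u v))"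
    for u v bs
  define len where "len j = width j + width (Suc j)" for j
  define query where "query = (\<lambda>(u, v). read_segment w (offset (k (min u v)))
      (len (k (min u v))) (answer u v))"

  have len: "len j div w \<le> K" for j
  proof -
    have "2 ^ len j \<le> (4 * n ^ 4 * n ^ 2) ^ 2"
      unfolding len_def
    proof (rule width_le)
      show "X j \<le> n ^ 4" for j unfolding X_def by (rule card_block_values_le[OF assms(1)])
      show "block_target n j \<le> n ^ 2" for j by (rule block_target_le[OF assms(1)])
    qed
    also have "\<dots> = 2 ^ 4 * n ^ 12"
      by (simp add: power_mult_distrib flip: power_mult power_add)
    finally have "real (2 ^ len j) \<le> real (2 ^ 4 * n ^ 12)" by (simp only: of_nat_le_iff)
    then have "log 2 (2 ^ len j) \<le> log 2 (2 ^ 4 * real n ^ 12)"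
      using assms(1) by (intro log_mono) auto
    also have "\<dots> = log 2 (2 ^ 4) + log 2 (real n ^ 12)"
      using assms(1) by (simp add: log_mult)
    also have "\<dots> = 12 * log 2 (real n) + 4"
      using assms(1) by (simp only: log_nat_power of_nat_0_less_iff) simp
    finally have "real (len j) \<le> 12 * log 2 (real n) + 4" by simp
    with w have "len j \<le> K * w" by linarith
    then have "len j div w \<le> K * w div w" by (rule div_le_mono)
    then show ?thesis using assms(2) by simp
  qed

  have x_less: "x e j < X j" if "e \<in> universal_representations n" for e j
  proof -
    have "restrict e (block n j) \<in> block_values n j"
      using that by (auto simp: universal_representations_def block_values_def block_def PiE_iff)
    then show ?thesis
      unfolding x_def X_def
      using to_nat_on_finite[OF finite_block_values[of n j]] by (auto dest: bij_betwE)
  qed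

  have result: "result w (memory m (x e)) (query (u, v)) = intersection_adj (vertex_interval e) u v"
    if e: "e \<in> universal_representations n" and uv: "u \<in> {1..n}" "v \<in> {1..n}" for e u v
  proof -
    let ?i = "min u v"
    have i: "?i \<in> {1..n}" using uv by auto
    then have k: "?i \<in> block n (k ?i)" "Suc (k ?i) < m"
      using block_count_bounds(1)[of n] by (auto simp: block_def k_def m_def)
    have "restrict e (block n (k ?i)) \<in> block_values n (k ?i)"
      using e by (auto simp: universal_representations_def block_values_def block_def PiE_iff)
    then have "from_nat_into (block_values n (k ?i)) (x e (k ?i)) ?i = e ?i"
      using k(1) by (simp add: x_def countable_finite)
    then show ?thesis
      by (simp add: query_def result_read_segment[OF assms(2)] answer_def len_def
          decode_segment[OF x_less[OF e] k(2)] adjacency_iff[OF e uv])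
  qed

  have "cell_probe_structure w (offset m) (K + 2) (universal_representations n) ({1..n} \<times> {1..n})
      (\<lambda>e (u, v). intersection_adj (vertex_interval e) u v) (\<lambda>e. memory m (x e)) query"
    unfolding cell_probe_structure_def
    using result len by (auto simp: length_memory query_def probes_read_segment)
  moreover have "real (offset m) \<le> log 2 (fact n) + 9 / ln 2"
  proof -
    have "(2 :: real) ^ offset m \<le> 2 ^ offset m * real (spill m)"
      using spill_pos[of m] by simp
    also note offset_bound
    also have "(\<Prod>j<m. real (X j)) = fact n"
      using arg_cong[OF prod_card_block_values[of n], of real]
      by (simp add: m_def X_def card_block_values block_empty)
    also have "(\<Sum>j<m. 1 / real (block_target n j) + 2 * real (block_target n j) / real (X j)) \<le> 9"
      using sum_loss[of n] by (simp only: m_def X_def)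
    finally have "(2 :: real) ^ offset m \<le> fact n * exp 9" by simp
    then have "log 2 (2 ^ offset m) \<le> log 2 (fact n * exp 9)" by (intro log_mono) auto
    then show ?thesis by (simp add: log_mult)
  qed
  ultimately show ?thesis by blast
qed

text \<open>Large \<open>n\<close> are covered by the asymptotic bound, those below its threshold
  \<open>N\<close> by log n <= n <= N and \<open>w n\<close> >= 1. The additive 4 is absorbed in the
  same way.\<close>

lemma word_size_bound:
  fixes w :: "nat \<Rightarrow> nat"
  assumes "\<And>n. w n > 0" and "(\<lambda>n. real (w n)) \<in> \<Theta>(\<lambda>n. log 2 (real n))"
  shows "\<exists>K. \<forall>n>0. 12 * log 2 (real n) + 4 \<le> real (K * w n)"
proof -
  obtain c where c: "c > 0" "eventually (\<lambda>n. norm (log 2 (real n)) \<le> c * norm (real (w n))) sequentially"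
    using assms(2) by (auto simp: bigtheta_def bigomega_iff_bigo elim: landau_o.bigE)
  then obtain N where N: "\<And>n. n \<ge> N \<Longrightarrow> norm (log 2 (real n)) \<le> c * norm (real (w n))"
    by (auto simp: eventually_sequentially)
  have log: "log 2 (real n) \<le> (c + real N) * real (w n)" if "n > 0" for n
  proof (cases "n \<ge> N")
    case True
    have "log 2 (real n) \<le> c * real (w n)" using N[OF True] by simp
    then show ?thesis by (simp add: distrib_right add_increasing2)
  next
    case False
    have "real n \<le> 2 powr real n" using of_nat_less_two_power[of n] by (simp add: powr_realpow less_imp_le)
    then have "log 2 (real n) \<le> real n * 1" using that by (simp add: log_le_iff)
    also have "real n * 1 \<le> real N * real (w n)"
      using False assms(1)[of n] by (intro mult_mono) (auto simp: Suc_le_eq)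
    finally show ?thesis using c(1) by (simp add: distrib_right add_increasing)
  qed
  obtain K where K: "12 * (c + real N) + 4 \<le> real K" using real_arch_simple by blast
  show ?thesis
  proof (intro exI allI impI)
    fix n :: nat assume "n > 0"
    have "12 * log 2 (real n) + 4 \<le> 12 * ((c + real N) * real (w n)) + 4 * real (w n)"
      using log[OF \<open>n > 0\<close>] assms(1)[of n] by (simp add: Suc_leI)
    also have "\<dots> = (12 * (c + real N) + 4) * real (w n)" by (simp add: algebra_simps)
    also have "\<dots> \<le> real K * real (w n)" using K by (intro mult_right_mono) auto
    finally show "12 * log 2 (real n) + 4 \<le> real (K * w n)" by simp
  qed
qed

theorem theorem4:
  fixes w :: "nat \<Rightarrow> nat"
  assumes "\<And>n. w n > 0"
    and "(\<lambda>n. real (w n)) \<in> \<Theta>(\<lambda>n. log 2 (real n))"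
  shows "\<exists>(preprocess :: nat \<Rightarrow> (nat \<Rightarrow> nat) \<Rightarrow> bool list)
          (query :: nat \<Rightarrow> nat \<times> nat \<Rightarrow> bool probe_algorithm)
          (s :: nat \<Rightarrow> nat) (t :: nat) (C :: real).
        \<forall>n\<ge>1.
          cell_probe_structure (w n) (s n) t
            (universal_representations n) ({1..n} \<times> {1..n})
            (\<lambda>e (u, v). intersection_adj (vertex_interval e) u v)
            (preprocess n) (query n) \<and>
          real (s n) \<le> log 2 (fact n) + C"
proof -
  from word_size_bound[OF assms]
  obtain K where K: "\<forall>n>0. 12 * log 2 (real n) + 4 \<le> real (K * w n)" ..
  \<comment> \<open>\<open>K\<close> is fixed before \<open>n\<close>, so the probe bound
    \<open>K + 2\<close> is uniform; the structures themselves are then chosen separately for each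
    \<open>n\<close>.\<close>
  have "\<forall>n. \<exists>preprocess query s. n \<ge> 1 \<longrightarrow>
      cell_probe_structure (w n) s (K + 2) (universal_representations n) ({1..n} \<times> {1..n})
        (\<lambda>e (u, v). intersection_adj (vertex_interval e) u v) preprocess query \<and>
      real s \<le> log 2 (fact n) + 9 / ln 2" (is "\<forall>n. \<exists>preprocess query s. ?P n preprocess query s")
  proof
    fix n
    show "\<exists>preprocess query s. ?P n preprocess query s"
    proof (cases "n \<ge> 1")
      case True
      then have "12 * log 2 (real n) + 4 \<le> real (K * w n)" using K by simp
      with True show ?thesis using adjacency_structure[of n "w n" K] assms(1)[of n] by simp
    qed simp
  qed
  from this[unfolded choice_iff] obtain preprocess query s
    where "\<forall>n. ?P n (preprocess n) (query n) (s n)"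
    by (elim exE) (rule that)
  then show ?thesis
    by (intro exI[of _ preprocess] exI[of _ query] exI[of _ s] exI[of _ "K + 2"] exI[of _ "9 / ln 2"])
qed

end
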